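(* Let $W$ and $\widetilde W$ be weight matrices of size $N$ supported on the same interval such that $\widetilde W$ is a strong Darboux transformation of $W$, and let $\mathcal V$ be a strong Darboux transformer from $W$ to $\widetilde W$, with $\mathcal N=\widetilde W\mathcal V^{\ast}W^{-1}$. If $\widetilde D\in\mathcal D(\widetilde W)$ is of even (respectively odd) order, then $\mathcal V\widetilde D\mathcal N\in\mathcal D(W)$ is of even (respectively odd) order.
   Context: A weight matrix of size $N$ on an interval $(x_0,x_1)\subseteq\mathbb R$ is a smooth function $W:(x_0,x_1)\to\operatorname{Mat}_N(\mathbb C)$ that is positive definite almost everywhere and has finite moments of all orders. Standing assumption on all weight matrices: for each $n\ge 0$ the derivative $W^{(n)}(x)$ decreases exponentially at infinity and there is a (nonzero) scalar polynomial $p_n$ such that $W^{(n)}p_n$ has finite moments. Put $\langle P,Q\rangle_W=\int_{x_0}^{x_1}P(x)W(x)Q(x)^*\,dx$ for $P,Q\in\operatorname{Mat}_N(\mathbb C[x])$. The monic orthogonal polynomials of $W$ are the unique $P_n\in\operatorname{Mat}_N(\mathbb C[x])$, $n\ge0$, of degree $n$ with leading coefficient $I$ and $\langle P_n,P_m\rangle_W=0$ for $n\ne m$. Differential operators $D=\sum_{i=0}^s\partial^iF_i(x)$, $\partial=d/dx$, act on the right on matrix functions: $P\cdot D=\sum_i P^{(i)}F_i$, and products satisfy $P\cdot(D_1D_2)=(P\cdot D_1)\cdot D_2$. The order of $D$ is the largest $s$ with $F_s\neq0$. $\operatorname{Mat}_N(\Omega[x])$ is the algebra of such operators with coefficients $F_i\in\operatorname{Mat}_N(\mathbb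 C[x])$. $$\mathcal D(W)=\{D\in\operatorname{Mat}_N(\Omega[x]): P_n\cdot D=\Lambda_n(D)P_n\text{ for some }\Lambda_n(D)\in\operatorname{Mat}_N(\mathbb C),\ \forall n\ge0\}.$$ The formal adjoint ${}^*$ is the involution (reversing products) extending the Hermitian conjugate on matrix functions and sending $\partial I$ to $-\partial I$; thus for $\mathcal V=\sum_j\partial^jF_j$ and $\mathcal N=\widetilde W\mathcal V^*W^{-1}$ one has $Q\cdot\mathcal N=\sum_j(-1)^j(Q\widetilde WF_j^* )^{(j)}W^{-1}$. An operator $\mathcal V\in\operatorname{Mat}_N(\Omega[x])$ is degree-preserving if $\deg(P\cdot\mathcal V)=\deg P$ for all $P\in\operatorname{Mat}_N(\mathbb C[x])$. Strong Darboux transformation: $\widetilde W$ is a strong Darboux transformation of $W$ (both of size $N$ on the same interval) if there is a degree-preserving differential operator $\mathcal V\in\operatorname{Mat}_N(\Omega[x])$ with nonsingular leading coefficient (i.e. the coefficient of its highest power of $\partial$ is a matrix polynomial whose determinant is not identically zero) such that $D=\mathcal V\mathcal N\in\mathcal D(W)$, where $\mathcal N=\widetilde W\mathcal V^*W^{-1}$ is a differential operator satisfying $\langle P\cdot\mathcal V,Q\rangle_{\widetilde W}=\langle P,Q\cdot\mathcal N\rangle_W$ for all $P,Q\in\operatorname{Mat}_N(\mathbb C[x])$. Such a $\mathcal V$ is called a strong Darboux transformer from $W$ to $\widetilde W$. *)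

theory Defs
  imports "HOL-Analysis.Analysis" "HOL-Library.Landau_Symbols" "HOL-Library.Function_Algebras"
begin

type_synonym 'n cmat = "complex ^ 'n ^ 'n"
type_synonym 'n mpoly = "complex poly ^ 'n ^ 'n"


subsection \<open>Matrix functions and matrix polynomials\<close>

definition hconj :: "'n::finite cmat \<Rightarrow> 'n cmat" where
  "hconj A = (\<chi> i j. cnj (A $ j $ i))"

definition pos_def :: "'n::finite cmat \<Rightarrow> bool" where
  "pos_def A \<longleftrightarrow> hconj A = A \<and>
     (\<forall>v. v \<noteq> 0 \<longrightarrow> Re (\<Sum>i\<in>UNIV. \<Sum>j\<in>UNIV. cnj (v $ i) * A $ i $ j * v $ j) > 0)"

definition iter_deriv :: "nat \<Rightarrow> (real \<Rightarrow> 'n::finite cmat) \<Rightarrow> real \<Rightarrow> 'n cmat" where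
  "iter_deriv k f = ((\<lambda>g x. vector_derivative g (at x)) ^^ k) f"

definition smooth_on_set :: "real set \<Rightarrow> (real \<Rightarrow> 'n::finite cmat) \<Rightarrow> bool" where
  "smooth_on_set S f \<longleftrightarrow> (\<forall>k. \<forall>x\<in>S. iter_deriv k f differentiable at x)"

definition meval :: "'n::finite mpoly \<Rightarrow> real \<Rightarrow> 'n cmat" where
  "meval P x = (\<chi> i j. poly (P $ i $ j) (of_real x))"

definition mcoeff :: "'n::finite mpoly \<Rightarrow> nat \<Rightarrow> 'n cmat" where
  "mcoeff P k = (\<chi> i j. coeff (P $ i $ j) k)"

definition mconst :: "'n::finite cmat \<Rightarrow> 'n mpoly" where
  "mconst A = (\<chi> i j. [:A $ i $ j:])"

definition mpderiv :: "'n::finite mpoly \<Rightarrow> 'n mpoly" where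
  "mpderiv P = (\<chi> i j. pderiv (P $ i $ j))"

text \<open>The zero polynomial has degree \<open>-\<infinity>\<close>; hence a degree-preserving operator (below) cannot
  annihilate a nonzero constant.\<close>

definition mdeg :: "'n::finite mpoly \<Rightarrow> ereal" where
  "mdeg P = (if P = 0 then - \<infinity> else ereal (real (Max (range (\<lambda>(i, j). degree (P $ i $ j))))))"


subsection \<open>Weight matrices\<close>

definition finite_moments :: "ereal \<Rightarrow> ereal \<Rightarrow> (real \<Rightarrow> 'n::finite cmat) \<Rightarrow> bool" where
  "finite_moments x0 x1 F \<longleftrightarrow>
     (\<forall>m. (\<lambda>x. x ^ m *\<^sub>R F x) absolutely_integrable_on einterval x0 x1)"

text \<open>Decay is a condition only at those endpoints of the interval that are infinite.\<close>

definition exp_decreasing :: "ereal \<Rightarrow> ereal \<Rightarrow> (real \<Rightarrow> 'n::finite cmat) \<Rightarrow> bool" where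
  "exp_decreasing x0 x1 F \<longleftrightarrow>
     (x1 = \<infinity> \<longrightarrow> (\<exists>c>0. (\<lambda>x. norm (F x)) \<in> O[at_top](\<lambda>x. exp (- c * x)))) \<and>
     (x0 = - \<infinity> \<longrightarrow> (\<exists>c>0. (\<lambda>x. norm (F x)) \<in> O[at_bot](\<lambda>x. exp (c * x))))"

text \<open>A weight on \<open>(x0, x1)\<close> is represented by a total function, whose values outside the interval are
  irrelevant. The factor \<open>mat (poly p x)\<close> below is the scalar polynomial \<open>p\<close> times the identity.\<close>

definition weight_matrix :: "ereal \<Rightarrow> ereal \<Rightarrow> (real \<Rightarrow> 'n::finite cmat) \<Rightarrow> bool" where
  "weight_matrix x0 x1 W \<longleftrightarrow>
     x0 < x1 \<and>
     smooth_on_set (einterval x0 x1) W \<and>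
     (AE x in lebesgue. x \<in> einterval x0 x1 \<longrightarrow> pos_def (W x)) \<and>
     finite_moments x0 x1 W \<and>
     (\<forall>n. exp_decreasing x0 x1 (iter_deriv n W) \<and>
          (\<exists>p :: complex poly. p \<noteq> 0 \<and>
             finite_moments x0 x1 (\<lambda>x. iter_deriv n W x ** mat (poly p (of_real x)))))"

definition inner_W ::
    "ereal \<Rightarrow> ereal \<Rightarrow> (real \<Rightarrow> 'n::finite cmat) \<Rightarrow> (real \<Rightarrow> 'n cmat) \<Rightarrow> (real \<Rightarrow> 'n cmat) \<Rightarrow> 'n cmat" where
  "inner_W x0 x1 W P Q =
     set_lebesgue_integral lebesgue (einterval x0 x1) (\<lambda>x. P x ** W x ** hconj (Q x))"

definition monic_orthogonal ::
    "ereal \<Rightarrow> ereal \<Rightarrow> (real \<Rightarrow> 'n::finite cmat) \<Rightarrow> (nat \<Rightarrow> 'n mpoly) \<Rightarrow> bool" where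
  "monic_orthogonal x0 x1 W P \<longleftrightarrow>
     (\<forall>n. mdeg (P n) = ereal (real n) \<and> mcoeff (P n) n = mat 1) \<and>
     (\<forall>n m. n \<noteq> m \<longrightarrow> inner_W x0 x1 W (meval (P n)) (meval (P m)) = 0)"


subsection \<open>Differential operators with matrix polynomial coefficients\<close>

text \<open>The type \<open>poly\<close> serves here only as the type of finitely supported coefficient sequences: an
  operator \<open>\<Sum>i. \<partial>\<^sup>i F\<^sub>i\<close> is the sequence with \<open>coeff D i = F\<^sub>i\<close>, so that \<open>degree D\<close> is
  the order of \<open>D \<noteq> 0\<close> and \<open>lead_coeff D\<close> is its leading coefficient. The library multiplication of
  polynomials is never used on this type.\<close>

type_synonym 'n pdop = "'n mpoly poly"

definition poly_act :: "'n::finite mpoly \<Rightarrow> 'n pdop \<Rightarrow> 'n mpoly" where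
  "poly_act P D = (\<Sum>i\<le>degree D. (mpderiv ^^ i) P ** coeff D i)"

text \<open>The order of the zero operator is undefined; it has neither even nor odd order.\<close>

definition even_order :: "'n::finite pdop \<Rightarrow> bool" where
  "even_order D \<longleftrightarrow> D \<noteq> 0 \<and> even (degree D)"

definition odd_order :: "'n::finite pdop \<Rightarrow> bool" where
  "odd_order D \<longleftrightarrow> D \<noteq> 0 \<and> odd (degree D)"

definition degree_preserving :: "'n::finite pdop \<Rightarrow> bool" where
  "degree_preserving V \<longleftrightarrow> (\<forall>P. mdeg (poly_act P V) = mdeg P)"

definition diff_algebra :: "ereal \<Rightarrow> ereal \<Rightarrow> (real \<Rightarrow> 'n::finite cmat) \<Rightarrow> 'n pdop set" where
  "diff_algebra x0 x1 W =
     {D. \<exists>P. monic_orthogonal x0 x1 W P \<and> (\<forall>n. \<exists>\<Lambda>. poly_act (P n) D = mconst \<Lambda> ** P n)}"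


subsection \<open>Differential operators with function coefficients\<close>

text \<open>These are needed because \<open>W\<^sup>-\<^sup>1\<close> and hence \<open>W' V\<^sup>* W\<^sup>-\<^sup>1\<close> need not have polynomial
  coefficients. Again \<open>poly\<close> is used only for its finitely supported sequences.\<close>

type_synonym 'n fdop = "(real \<Rightarrow> 'n cmat) poly"

definition fdop_of :: "'n::finite pdop \<Rightarrow> 'n fdop" where
  "fdop_of D = map_poly meval D"

definition fun_act :: "(real \<Rightarrow> 'n::finite cmat) \<Rightarrow> 'n fdop \<Rightarrow> real \<Rightarrow> 'n cmat" where
  "fun_act f D x = (\<Sum>i\<le>degree D. iter_deriv i f x ** coeff D i x)"

text \<open>Operators act on the right, \<open>f \<cdot> (D E) = (f \<cdot> D) \<cdot> E\<close>, so that by the Leibniz rule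
  \<open>(\<partial>\<^sup>i F) (\<partial>\<^sup>j G) = (\<Sum>k\<le>j. (j choose k) \<partial>\<^sup>i\<^sup>+\<^sup>k F\<^sup>(\<^sup>j\<^sup>-\<^sup>k\<^sup>) G)\<close>.\<close>

definition op_mult :: "'n::finite fdop \<Rightarrow> 'n fdop \<Rightarrow> 'n fdop" (infixl "\<odot>" 70) where
  "D \<odot> E = (\<Sum>i\<le>degree D. \<Sum>j\<le>degree E. \<Sum>k\<le>j.
     monom (\<lambda>x. of_nat (j choose k) *\<^sub>R (iter_deriv (j - k) (coeff D i) x ** coeff E j x)) (i + k))"

definition fun_op :: "(real \<Rightarrow> 'n::finite cmat) \<Rightarrow> 'n fdop" where
  "fun_op F = monom F 0"

text \<open>\<open>(\<partial>\<^sup>j F)\<^sup>* = F\<^sup>* (-\<partial>)\<^sup>j\<close>.\<close>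

definition formal_adjoint :: "'n::finite fdop \<Rightarrow> 'n fdop" where
  "formal_adjoint D =
     (\<Sum>j\<le>degree D. fun_op (\<lambda>x. (- 1) ^ j *\<^sub>R hconj (coeff D j x)) \<odot> monom (\<lambda>x. mat 1) j)"

definition darboux_N ::
    "(real \<Rightarrow> 'n::finite cmat) \<Rightarrow> (real \<Rightarrow> 'n cmat) \<Rightarrow> 'n pdop \<Rightarrow> 'n fdop" where
  "darboux_N W W' V =
     fun_op W' \<odot> formal_adjoint (fdop_of V) \<odot> fun_op (\<lambda>x. matrix_inv (W x))"

text \<open>A weight may be singular on a null set of the interval, where \<open>matrix_inv (W x)\<close> is meaningless.
  Operators involving \<open>W\<^sup>-\<^sup>1\<close> are therefore compared on the remaining open, dense subset of the
  interval. As it is infinite, at most one \<open>E\<close> satisfies \<open>represents x0 x1 W T E\<close>.\<close>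

definition represents ::
    "ereal \<Rightarrow> ereal \<Rightarrow> (real \<Rightarrow> 'n::finite cmat) \<Rightarrow> 'n fdop \<Rightarrow> 'n pdop \<Rightarrow> bool" where
  "represents x0 x1 W T E \<longleftrightarrow>
     (\<forall>k. \<forall>x\<in>einterval x0 x1. invertible (W x) \<longrightarrow> coeff T k x = meval (coeff E k) x)"


subsection \<open>Strong Darboux transformations\<close>

definition strong_darboux_transformer ::
    "ereal \<Rightarrow> ereal \<Rightarrow> (real \<Rightarrow> 'n::finite cmat) \<Rightarrow> (real \<Rightarrow> 'n cmat) \<Rightarrow> 'n pdop \<Rightarrow> bool" where
  "strong_darboux_transformer x0 x1 W W' V \<longleftrightarrow>
     degree_preserving V \<and>
     det (lead_coeff V) \<noteq> 0 \<and>
     (\<exists>D \<in> diff_algebra x0 x1 W. represents x0 x1 W (fdop_of V \<odot> darboux_N W W' V) D) \<and>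
     (\<forall>P Q. inner_W x0 x1 W' (meval (poly_act P V)) (meval Q) =
            inner_W x0 x1 W (meval P) (fun_act (meval Q) (darboux_N W W' V)))"

definition strong_darboux_transformation ::
    "ereal \<Rightarrow> ereal \<Rightarrow> (real \<Rightarrow> 'n::finite cmat) \<Rightarrow> (real \<Rightarrow> 'n cmat) \<Rightarrow> bool" where
  "strong_darboux_transformation x0 x1 W W' \<longleftrightarrow> (\<exists>V. strong_darboux_transformer x0 x1 W W' V)"

end

theory Submission
  imports Defs
begin

text \<open>
  Since \<open>V\<close> preserves degrees, it is onto the matrix polynomials, and \<open>V N = D\<close> has polynomial
  coefficients; hence \<open>N\<close> maps polynomials to polynomials, so it has polynomial coefficients too, and
  so does \<open>E = V D' N\<close>. By the adjointness of \<open>V\<close> and \<open>N\<close> the polynomials \<open>P\<^sub>n \<cdot> V\<close> are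
  orthogonal for \<open>W'\<close>, so by uniqueness \<open>P\<^sub>n \<cdot> V = C\<^sub>n P'\<^sub>n\<close> with \<open>C\<^sub>n\<close> invertible, and
  therefore \<open>P\<^sub>n \<cdot> E = C\<^sub>n \<Lambda>'\<^sub>n C\<^sub>n\<^sup>-\<^sup>1 \<Lambda>\<^sub>n P\<^sub>n\<close>. If \<open>F\<close> and \<open>L\<close> are the leading
  coefficients of \<open>V\<close> and \<open>D'\<close>, and \<open>v\<close> and \<open>d\<close> their orders, then the coefficient of
  \<open>\<partial>\<close> to the power \<open>2 v + d\<close> in \<open>E\<close> is \<open>F L (-1)\<^sup>v W' F\<^sup>* W\<^sup>-\<^sup>1\<close>, which vanishes only where
  \<open>L\<close> does, up to a null set. So \<open>E\<close> has order \<open>2 v + d\<close>.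
\<close>

section \<open>Evaluation and derivatives of matrix polynomials\<close>

lemma bounded_bilinear_cmat_mult:
  "bounded_bilinear ((**) :: complex^'n::finite^'n \<Rightarrow> complex^'n^'n \<Rightarrow> complex^'n^'n)"
proof -
  have "bilinear ((**) :: complex^'n::finite^'n \<Rightarrow> complex^'n^'n \<Rightarrow> complex^'n^'n)"
    unfolding bilinear_def
    by (auto intro!: linearI simp: matrix_add_ldistrib matrix_matrix_mult_def
        vec_eq_iff scaleR_sum_right sum.distrib algebra_simps)
  then show ?thesis
    by (simp add: bilinear_conv_bounded_bilinear)
qed

text \<open>Supplies distribution over sums and real scalars, and the bounded linearity that moves
  constant matrices through integrals.\<close>

interpretation cmat_mult:
  bounded_bilinear "(**) :: complex^'n::finite^'n \<Rightarrow> complex^'n^'n \<Rightarrow> complex^'n^'n"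
  by (rule bounded_bilinear_cmat_mult)

lemma meval_0 [simp]: "meval 0 = 0"
  and meval_add: "meval (P + Q) x = meval P x + meval Q x"
  and meval_diff: "meval (P - Q) x = meval P x - meval Q x"
  and meval_mult: "meval (P ** Q) x = meval P x ** meval Q x"
  and meval_mconst [simp]: "meval (mconst A) x = A"
  and meval_mat [simp]: "meval (mat p) x = mat (poly p (of_real x))"
  by (auto simp: meval_def mconst_def vec_eq_iff fun_eq_iff matrix_matrix_mult_def poly_sum mat_def)

lemma meval_sum: "meval (sum f A) x = (\<Sum>i\<in>A. meval (f i) x)"
  by (induction A rule: infinite_finite_induct) (simp_all add: meval_add)

text \<open>A nonzero entry of \<open>P - Q\<close> would have only finitely many roots. Identities
  known only where a weight is invertible thus become identities of polynomials.\<close>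

lemma meval_eqI:
  assumes "infinite S" and "\<And>x. x \<in> S \<Longrightarrow> meval P x = meval Q x"
  shows "P = Q"
proof -
  have "P $ i $ j - Q $ i $ j = 0" for i j
  proof (rule ccontr)
    assume "P $ i $ j - Q $ i $ j \<noteq> 0"
    then have "finite {z. poly (P $ i $ j - Q $ i $ j) z = 0}"
      by (rule poly_roots_finite)
    moreover have "complex_of_real ` S \<subseteq> {z. poly (P $ i $ j - Q $ i $ j) z = 0}"
      using assms(2) by (fastforce simp: meval_def vec_eq_iff)
    ultimately have "finite (complex_of_real ` S)"
      using finite_subset by blast
    then show False
      using assms(1) by (metis finite_imageD inj_of_real inj_on_subset top_greatest)
  qed
  then show ?thesis
    by (simp add: vec_eq_iff)
qed

lemma meval_inj: "(\<And>x. meval P x = meval Q x) \<Longrightarrow> P = Q"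
  by (rule meval_eqI[OF infinite_UNIV_char_0]) auto

lemma meval_eq_iff: "meval P = meval Q \<longleftrightarrow> P = Q"
  using meval_inj by metis

lemma mpderiv_pow_nth: "(mpderiv ^^ n) P $ i $ j = (pderiv ^^ n) (P $ i $ j)"
  by (induction n) (simp_all add: mpderiv_def)

lemma mpderiv_pow_add: "(mpderiv ^^ n) (P + Q) = (mpderiv ^^ n) P + (mpderiv ^^ n) Q"
  by (simp add: vec_eq_iff mpderiv_pow_nth higher_pderiv_add)

lemma mpderiv_pow_sum: "(mpderiv ^^ n) (\<Sum>i\<in>A. f i) = (\<Sum>i\<in>A. (mpderiv ^^ n) (f i))"
  by (induction A rule: infinite_finite_induct) (simp_all add: mpderiv_pow_add vec_eq_iff mpderiv_pow_nth)

text \<open>Leibniz rule: one derivative is taken first, the induction hypothesis is applied to both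
  resulting products, and Pascal's rule merges the two sums.\<close>

lemma higher_pderiv_mult:
  fixes p q :: "'a :: idom poly"
  shows "(pderiv ^^ n) (p * q) =
    (\<Sum>k\<le>n. of_nat (n choose k) * ((pderiv ^^ k) p * (pderiv ^^ (n - k)) q))"
proof (induction n arbitrary: p q)
  case (Suc n)
  define t where "t = (\<lambda>k. (pderiv ^^ k) p * (pderiv ^^ (Suc n - k)) q)"
  have "(pderiv ^^ Suc n) (p * q) = (pderiv ^^ n) (pderiv p * q) + (pderiv ^^ n) (p * pderiv q)"
    by (simp only: funpow_Suc_right comp_def pderiv_mult higher_pderiv_add) (simp add: mult.commute add.commute)
  also have "(pderiv ^^ n) (pderiv p * q) = (\<Sum>k\<le>n. of_nat (n choose k) * t (Suc k))"
    by (simp only: Suc.IH t_def funpow_Suc_right comp_def diff_Suc_Suc)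
  also have "(pderiv ^^ n) (p * pderiv q) = (\<Sum>k\<le>n. of_nat (n choose k) * t k)"
  proof -
    have "(pderiv ^^ (n - k)) (pderiv q) = (pderiv ^^ (Suc n - k)) q" if "k \<le> n" for k
      using that by (simp only: Suc_diff_le funpow_Suc_right comp_def)
    then show ?thesis
      unfolding Suc.IH t_def by (intro sum.cong) simp_all
  qed
  \<comment> \<open>The added term has coefficient \<open>n choose Suc n\<close>, which is 0; it
    prepares the index shift.\<close>
  also have "\<dots> = (\<Sum>k\<le>Suc n. of_nat (n choose k) * t k)"
    by (simp add: binomial_eq_0)
  also have "\<dots> = t 0 + (\<Sum>k\<le>n. of_nat (n choose Suc k) * t (Suc k))"
    by (subst sum.atMost_Suc_shift) simp
  also have "(\<Sum>k\<le>n. of_nat (n choose k) * t (Suc k)) + (t 0 + (\<Sum>k\<le>n. of_nat (n choose Suc k) * t (Suc k)))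
     = (\<Sum>k\<le>Suc n. of_nat (Suc n choose k) * t k)"
    by (subst sum.atMost_Suc_shift) (simp add: algebra_simps sum.distrib)
  finally show ?case
    unfolding t_def .
qed simp

text \<open>Links the analytic derivatives in \<open>fun_act\<close> and \<open>op_mult\<close> with
  the formal ones in \<open>poly_act\<close>; differentiation is entrywise.\<close>

lemma iter_deriv_meval: "iter_deriv k (meval P) = meval ((mpderiv ^^ k) P)"
proof (induction k)
  case 0
  then show ?case by (simp add: iter_deriv_def)
next
  case (Suc k)
  have "(meval Q has_vector_derivative meval (mpderiv Q) x) (at x)" for Q :: "'a mpoly" and x
  proof -
    have "((\<lambda>x. poly (Q $ i $ j) (complex_of_real x)) has_vector_derivative
        poly (pderiv (Q $ i $ j)) (of_real x)) (at x)" for i j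
      by (intro has_vector_derivative_real_field poly_DERIV)
    then have "((\<lambda>x. poly (Q $ i $ j) (complex_of_real x)) has_derivative
        (\<lambda>h. h *\<^sub>R poly (pderiv (Q $ i $ j)) (of_real x))) (at x)" for i j
      by (simp add: has_vector_derivative_def)
    note * = this
    show ?thesis
      unfolding has_vector_derivative_def
      by (subst has_derivative_componentwise_within, simp add: Basis_vec_def inner_axis meval_def mpderiv_def)
        (auto intro!: derivative_eq_intros *)
  qed
  then have "(\<lambda>x. vector_derivative (meval Q) (at x)) = meval (mpderiv Q)" for Q :: "'a mpoly"
    by (auto intro: vector_derivative_at)
  with Suc show ?case by (simp add: iter_deriv_def)
qed

text \<open>Stated after evaluation, so that the binomial coefficients are real scalars as in
  \<open>op_mult\<close>.\<close>

lemma meval_mpderiv_pow_mult: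
  "meval ((mpderiv ^^ n) (A ** B)) x =
    (\<Sum>k\<le>n. of_nat (n choose k) *\<^sub>R (meval ((mpderiv ^^ k) A) x ** meval ((mpderiv ^^ (n - k)) B) x))"
  (is "?l = ?r")
proof -
  have "?l $ i $ j = ?r $ i $ j" for i j
    by (simp add: meval_def mpderiv_pow_nth matrix_matrix_mult_def higher_pderiv_sum higher_pderiv_mult
        poly_sum, subst sum.swap)
      (simp add: sum_distrib_left scaleR_conv_of_real)
  then show ?thesis
    by (simp only: vec_eq_iff) blast
qed

section \<open>Action and product of operators with function coefficients\<close>

lemma fun_act_mono_degree: "degree D \<le> n \<Longrightarrow> fun_act f D x = (\<Sum>i\<le>n. iter_deriv i f x ** coeff D i x)"
  unfolding fun_act_def
  by (rule sum.mono_neutral_left) (auto simp: coeff_eq_0)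

lemma coeff_fdop_of: "coeff (fdop_of D) k = meval (coeff D k)"
  by (simp add: fdop_of_def coeff_map_poly)

lemma degree_fdop_of: "degree (fdop_of D) = degree D"
proof (cases "D = 0")
  case False
  then show ?thesis unfolding fdop_of_def
    by (metis degree_map_poly leading_coeff_0_iff meval_0 meval_eq_iff)
qed (simp add: fdop_of_def)

lemma meval_poly_act: "meval (poly_act P D) = fun_act (meval P) (fdop_of D)"
  by (simp add: fun_eq_iff poly_act_def fun_act_def degree_fdop_of coeff_fdop_of meval_sum meval_mult iter_deriv_meval)

lemma fun_act_add: "fun_act f (D + E) x = fun_act f D x + fun_act f E x"
proof -
  let ?n = "max (degree D) (degree E)"
  show ?thesis
    by (simp add: fun_act_mono_degree[of _ ?n] degree_add_le matrix_add_ldistrib sum.distrib)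
qed

lemma fun_act_sum: "fun_act f (sum D A) x = (\<Sum>i\<in>A. fun_act f (D i) x)"
  by (induction A rule: infinite_finite_induct) (simp_all add: fun_act_add, simp_all add: fun_act_def)

lemma fun_act_monom: "fun_act f (monom c n) x = iter_deriv n f x ** c x"
  by (subst fun_act_mono_degree[OF degree_monom_le]) (simp add: if_distrib if_distribR cong: if_cong)

lemma sum_fun_apply: "sum f A x = (\<Sum>i\<in>A. f i x)"
  by (induction A rule: infinite_finite_induct) simp_all

lemma coeff_op_mult:
  "coeff (D \<odot> E) m x = (\<Sum>i\<le>degree D. \<Sum>j\<le>degree E. \<Sum>k\<le>j.
     if i + k = m then of_nat (j choose k) *\<^sub>R (iter_deriv (j - k) (coeff D i) x ** coeff E j x) else 0)"
  by (auto simp add: op_mult_def coeff_sum sum_fun_apply intro!: sum.cong)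

text \<open>Both sides agree by the Leibniz rule. The product differentiates only the coefficients
  of its left factor, here polynomials, so those of \<open>T\<close> may be arbitrary functions, as
  for \<open>darboux_N\<close>.\<close>

lemma fun_act_op_mult:
  "fun_act (meval P) (fdop_of V \<odot> T) x = fun_act (meval (poly_act P V)) T x"
proof -
  have "fun_act (meval P) (fdop_of V \<odot> T) x =
      (\<Sum>i\<le>degree V. \<Sum>j\<le>degree T. \<Sum>k\<le>j. of_nat (j choose k) *\<^sub>R
        (meval ((mpderiv ^^ (k + i)) P) x ** (meval ((mpderiv ^^ (j - k)) (coeff V i)) x ** coeff T j x)))"
    by (simp add: op_mult_def fun_act_sum fun_act_monom degree_fdop_of coeff_fdop_of iter_deriv_meval
        cmat_mult.scaleR_right add.commute)
  also have "\<dots> = (\<Sum>j\<le>degree T. \<Sum>i\<le>degree V. \<Sum>k\<le>j. of_nat (j choose k) *\<^sub>R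
        (meval ((mpderiv ^^ (k + i)) P) x ** (meval ((mpderiv ^^ (j - k)) (coeff V i)) x ** coeff T j x)))"
    by (rule sum.swap)
  also have "\<dots> = fun_act (meval (poly_act P V)) T x"
    by (simp add: fun_act_def poly_act_def iter_deriv_meval mpderiv_pow_sum meval_sum meval_mpderiv_pow_mult
        cmat_mult.sum_left cmat_mult.scaleR_left matrix_mul_assoc funpow_add)
  finally show ?thesis .
qed

subsection \<open>Degrees of matrix polynomials\<close>

lemma mcoeff_diff: "mcoeff (P - Q) k = mcoeff P k - mcoeff Q k"
  and mcoeff_0 [simp]: "mcoeff 0 k = 0"
  and mcoeff_mconst_mult: "mcoeff (mconst A ** P) k = A ** mcoeff P k"
  by (simp_all add: mcoeff_def mconst_def vec_eq_iff matrix_matrix_mult_def coeff_sum)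

lemma mcoeff_eq_0_iff: "(\<forall>k. mcoeff P k = 0) \<longleftrightarrow> P = 0"
  by (auto simp: mcoeff_def vec_eq_iff poly_eq_iff)

text \<open>Trades the maximum of the entry degrees for conditions on matrix coefficients, which are
  easy to follow under multiplication by constant matrices.\<close>

lemma mdeg_eq_iff:
  "mdeg P = ereal (real n) \<longleftrightarrow> (\<forall>k>n. mcoeff P k = 0) \<and> mcoeff P n \<noteq> 0"
proof
  assume *: "mdeg P = ereal (real n)"
  then have "P \<noteq> 0"
    by (auto simp: mdeg_def)
  with * have M: "Max (range (\<lambda>(i, j). degree (P $ i $ j))) = n"
    by (simp add: mdeg_def)
  have le: "degree (P $ i $ j) \<le> n" for i j
    unfolding M[symmetric] by (rule Max_ge) auto
  have "n \<in> range (\<lambda>(i, j). degree (P $ i $ j))"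
    unfolding M[symmetric] by (rule Max_in) auto
  then obtain i j where ij: "degree (P $ i $ j) = n"
    by auto
  have top: "\<forall>k>n. mcoeff P k = 0"
    using le by (auto simp: mcoeff_def vec_eq_iff intro!: coeff_eq_0 intro: le_less_trans)
  moreover have "mcoeff P n \<noteq> 0"
  \<comment> \<open>An entry of degree 0 may be the zero polynomial, so for \<open>n = 0\<close> the
    nonzero coefficient has to come from \<open>P \<noteq> 0\<close>.\<close>
  proof (cases "n = 0")
    case True
    then show ?thesis
      using top \<open>P \<noteq> 0\<close> mcoeff_eq_0_iff by (metis gr0I)
  next
    case False
    then have "coeff (P $ i $ j) n \<noteq> 0"
      using ij by (metis degree_0 leading_coeff_0_iff)
    then show ?thesis
      by (auto simp: mcoeff_def vec_eq_iff)
  qed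
  ultimately show "(\<forall>k>n. mcoeff P k = 0) \<and> mcoeff P n \<noteq> 0"
    by blast
next
  assume *: "(\<forall>k>n. mcoeff P k = 0) \<and> mcoeff P n \<noteq> 0"
  then obtain i j where ij: "coeff (P $ i $ j) n \<noteq> 0"
    by (auto simp: mcoeff_def vec_eq_iff)
  have le: "degree (P $ i $ j) \<le> n" for i j
    using * by (intro degree_le) (auto simp: mcoeff_def vec_eq_iff)
  have "degree (P $ i $ j) = n"
    using le ij le_degree antisym by metis
  then have "Max (range (\<lambda>(i, j). degree (P $ i $ j))) = n"
    using le by (intro Max_eqI) (auto intro: rev_image_eqI[of "(i, j)"])
  moreover have "P \<noteq> 0"
    using * by auto
  ultimately show "mdeg P = ereal (real n)"
    by (simp add: mdeg_def)
qed

lemma mcoeff_eventually_0: "\<exists>d. \<forall>k\<ge>d. mcoeff P k = 0"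
proof (cases "P = 0")
  case False
  then have "mdeg P = ereal (real (Max (range (\<lambda>(i, j). degree (P $ i $ j)))))"
    by (simp add: mdeg_def)
  then show ?thesis
    unfolding mdeg_eq_iff by (metis Suc_le_eq)
qed auto

lemma invertible_if_left_cancel:
  fixes C :: "'n::finite cmat"
  assumes "\<And>A :: 'n cmat. A ** C = 0 \<Longrightarrow> A = 0"
  shows "invertible C"
proof -
  have "x = 0" if "transpose C *v x = 0" for x
  proof -
    \<comment> \<open>A kernel vector \<open>x\<close> of the transpose becomes a matrix all of
      whose rows are \<open>x\<close>, to which the cancellation hypothesis applies.\<close>
    have "(\<chi> i j. x $ j) ** C = (0 :: 'n cmat)"
      using that by (simp add: vec_eq_iff matrix_matrix_mult_def matrix_vector_mult_def transpose_def mult.commute)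
    then have "(\<chi> i j. x $ j) = (0 :: 'n cmat)"
      by (rule assms)
    then show ?thesis
      by (simp add: vec_eq_iff)
  qed
  then have "invertible (transpose C)"
    by (simp add: invertible_left_inverse matrix_left_invertible_ker)
  then show ?thesis
    by (simp add: invertible_det_nz det_transpose)
qed

lemma matrix_inv_inverse:
  assumes "invertible A"
  shows "A ** matrix_inv A = mat 1" and "matrix_inv A ** A = mat 1"
  using someI_ex[OF assms[unfolded invertible_def]] by (auto simp: matrix_inv_def)

text \<open>Polynomials \<open>R n\<close> of degree \<open>n\<close> with invertible leading
  coefficient form a basis over constant matrices acting from the left, so \<open>Q\<close> is built
  from \<open>R 0, ..., R (d - 1)\<close>. The bound \<open>n < d\<close> is handed to the step
  because orthogonality to lower degrees relies on it.\<close>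

lemma mpoly_basis_induct [consumes 1, case_names basis zero step]:
  assumes "\<forall>k\<ge>d. mcoeff Q k = 0"
    and "\<And>n. n < d \<Longrightarrow> (\<forall>k>n. mcoeff (R n) k = 0) \<and> invertible (mcoeff (R n) n)"
    and "\<Phi> 0"
    and step: "\<And>n A Q. n < d \<Longrightarrow> \<Phi> Q \<Longrightarrow> \<Phi> (Q + mconst A ** R n)"
  shows "\<Phi> Q"
  using assms(1,2) step
proof (induction d arbitrary: Q)
  case 0
  then show ?case
    using mcoeff_eq_0_iff[of Q] assms(3) by simp
next
  case (Suc d)
  \<comment> \<open>Chosen so that subtracting \<open>mconst A ** R d\<close> cancels the
    coefficient of \<open>Q\<close> at \<open>d\<close>.\<close>
  define A where "A = mcoeff Q d ** matrix_inv (mcoeff (R d) d)"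
  have R: "\<forall>k>d. mcoeff (R d) k = 0" "invertible (mcoeff (R d) d)"
    using Suc.prems(2)[of d] by simp_all
  have "mcoeff (Q - mconst A ** R d) k = 0" if "k \<ge> d" for k
  proof (cases "k = d")
    case True
    then show ?thesis
      using matrix_inv_inverse(2)[OF R(2)] by (simp add: mcoeff_diff mcoeff_mconst_mult A_def flip: matrix_mul_assoc)
  next
    case False
    then show ?thesis
      using that R(1) Suc.prems(1) by (simp add: mcoeff_diff mcoeff_mconst_mult)
  qed
  then have "\<forall>k\<ge>d. mcoeff (Q - mconst A ** R d) k = 0"
    by blast
  then have "\<Phi> (Q - mconst A ** R d)"
  proof (rule Suc.IH)
    show "(\<forall>k>n. mcoeff (R n) k = 0) \<and> invertible (mcoeff (R n) n)" if "n < d" for n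
      using that by (intro Suc.prems(2)) simp
    show "\<Phi> (Q + mconst A ** R n)" if "n < d" "\<Phi> Q" for n A Q
      using that by (intro Suc.prems(3)) simp_all
  qed
  then have "\<Phi> (Q - mconst A ** R d + mconst A ** R d)"
    by (rule Suc.prems(3)[OF lessI])
  then show ?case
    by simp
qed

lemma mpderiv_pow_mconst_mult: "(mpderiv ^^ k) (mconst A ** P) = mconst A ** (mpderiv ^^ k) P"
  by (simp add: vec_eq_iff mpderiv_pow_nth mconst_def matrix_matrix_mult_def higher_pderiv_sum higher_pderiv_smult)

lemma poly_act_add: "poly_act (P + Q) D = poly_act P D + poly_act Q D"
  by (rule meval_inj)
    (simp add: poly_act_def meval_sum meval_mult meval_add mpderiv_pow_add cmat_mult.add_left sum.distrib)

lemma poly_act_mconst_mult: "poly_act (mconst A ** P) D = mconst A ** poly_act P D"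
  by (rule meval_inj)
    (simp add: poly_act_def meval_sum meval_mult mpderiv_pow_mconst_mult cmat_mult.sum_right matrix_mul_assoc)

text \<open>For constant \<open>A \<noteq> 0\<close> the polynomial \<open>mconst A ** P\<close>
  still has degree \<open>n\<close>, hence so does its image. The coefficient of that image at
  \<open>n\<close> is \<open>A\<close> times that of the image of \<open>P\<close>, so no nonzero
  \<open>A\<close> annihilates the latter.\<close>

lemma degree_preserving_lead:
  assumes "degree_preserving V" and "mdeg P = ereal (real n)" and "mcoeff P n = mat 1"
  shows "\<forall>k>n. mcoeff (poly_act P V) k = 0" and "invertible (mcoeff (poly_act P V) n)"
proof -
  show "\<forall>k>n. mcoeff (poly_act P V) k = 0"
    using assms mdeg_eq_iff unfolding degree_preserving_def by metis
  show "invertible (mcoeff (poly_act P V) n)"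
  proof (rule invertible_if_left_cancel, rule ccontr)
    fix A :: "'a cmat"
    assume A: "A ** mcoeff (poly_act P V) n = 0" "A \<noteq> 0"
    have "mdeg (mconst A ** P) = ereal (real n)"
      using assms(2,3) A(2) by (simp add: mdeg_eq_iff mcoeff_mconst_mult)
    then have "mdeg (mconst A ** poly_act P V) = ereal (real n)"
      using assms(1) by (metis degree_preserving_def poly_act_mconst_mult)
    then show False
      using A(1) by (simp add: mdeg_eq_iff mcoeff_mconst_mult)
  qed
qed

text \<open>The images of the powers \<open>x^n\<close> times the identity have degree
  \<open>n\<close> and invertible leading coefficients, so every \<open>Q\<close> is a left
  combination of them, and the action is left linear.\<close>

lemma degree_preserving_surj:
  assumes "degree_preserving V"
  shows "\<exists>P. poly_act P V = Q"
proof -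
  define R :: "nat \<Rightarrow> 'a mpoly" where "R n = (\<chi> i j. if i = j then monom 1 n else 0)" for n
  have R: "mcoeff (R n) k = (if k = n then mat 1 else 0)" for n k
    by (simp add: R_def mcoeff_def mat_def vec_eq_iff)
  then have "mdeg (R n) = ereal (real n)" for n
    by (simp add: mdeg_eq_iff) (simp add: vec_eq_iff mat_def)
  note lead = degree_preserving_lead[OF assms this]
  obtain d where d: "\<forall>k\<ge>d. mcoeff Q k = 0"
    using mcoeff_eventually_0 by blast
  show ?thesis
    using d
  proof (induction rule: mpoly_basis_induct[where R = "\<lambda>n. poly_act (R n) V"])
    case (basis n)
    then show ?case using lead R by metis
  next
    case zero
    have "poly_act (0 + 0) V = poly_act 0 V + poly_act 0 V"
      by (rule poly_act_add)
    then show ?case by auto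
  next
    case (step n A Q)
    then show ?case
      by (metis poly_act_add poly_act_mconst_mult)
  qed
qed

subsection \<open>Matrix-valued inner products\<close>

text \<open>Brings a matrix polynomial into the form of real powers times constant matrices, to
  match \<open>finite_moments\<close>.\<close>

lemma meval_expand:
  assumes "\<forall>k\<ge>d. mcoeff P k = 0"
  shows "meval P x = (\<Sum>k<d. x ^ k *\<^sub>R mcoeff P k)"
proof -
  have "poly (P $ i $ j) (complex_of_real x) = (\<Sum>k<d. x ^ k *\<^sub>R coeff (P $ i $ j) k)" for i j
  proof -
    have "poly (P $ i $ j) (complex_of_real x) =
        (\<Sum>k<max d (Suc (degree (P $ i $ j))). coeff (P $ i $ j) k * of_real x ^ k)"
      unfolding poly_altdef by (rule sum.mono_neutral_left) (auto simp: coeff_eq_0)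
    also have "\<dots> = (\<Sum>k<d. coeff (P $ i $ j) k * of_real x ^ k)"
      using assms by (intro sum.mono_neutral_right) (auto simp: mcoeff_def vec_eq_iff)
    finally show ?thesis
      by (simp add: scaleR_conv_of_real mult.commute)
  qed
  then show ?thesis
    by (simp add: meval_def mcoeff_def vec_eq_iff)
qed

lemma hconj_nth [simp]: "hconj A $ i $ j = cnj (A $ j $ i)"
  by (simp add: hconj_def)

lemma hconj_mult: "hconj (A ** B) = hconj B ** hconj A"
  by (simp add: vec_eq_iff matrix_matrix_mult_def mult.commute)

lemma hconj_add: "hconj (A + B) = hconj A + hconj B"
  and hconj_0 [simp]: "hconj 0 = 0"
  and hconj_scaleR: "hconj (r *\<^sub>R A) = r *\<^sub>R hconj A"
  by (simp_all add: vec_eq_iff)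

lemma hconj_sum: "hconj (sum f A) = (\<Sum>i\<in>A. hconj (f i))"
  by (induction A rule: infinite_finite_induct) (simp_all add: hconj_add)

lemma invertible_hconj: "invertible A \<Longrightarrow> invertible (hconj A)"
proof -
  assume "invertible A"
  then obtain B where "A ** B = mat 1" "B ** A = mat 1"
    unfolding invertible_def by blast
  then have "hconj B ** hconj A = mat 1" "hconj A ** hconj B = mat 1"
    unfolding hconj_mult[symmetric] by (simp_all add: vec_eq_iff mat_def)
  then show ?thesis
    unfolding invertible_def by blast
qed

text \<open>The integrand is a finite sum of moments \<open>x ^ m *\<^sub>R W x\<close> between
  constant matrices.\<close>

lemma weight_integrable:
  assumes "finite_moments x0 x1 W"
  shows "(\<lambda>x. meval P x ** W x ** hconj (meval Q x)) absolutely_integrable_on einterval x0 x1"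
proof -
  obtain d e where d: "\<forall>k\<ge>d. mcoeff P k = 0" and e: "\<forall>k\<ge>e. mcoeff Q k = 0"
    using mcoeff_eventually_0 by metis
  have "(\<lambda>x. A ** (x ^ m *\<^sub>R W x) ** B) absolutely_integrable_on einterval x0 x1" for A B :: "'a cmat" and m
  proof -
    have "bounded_linear (\<lambda>X. A ** X ** B)"
      using bounded_linear_compose[OF cmat_mult.bounded_linear_left cmat_mult.bounded_linear_right] .
    then have "(\<lambda>X. A ** X ** B) \<circ> (\<lambda>x. x ^ m *\<^sub>R W x) absolutely_integrable_on einterval x0 x1"
      using assms by (intro absolutely_integrable_linear) (simp_all add: finite_moments_def)
    then show ?thesis
      by (simp add: comp_def)
  qed
  then have "(\<lambda>x. \<Sum>k<d. \<Sum>l<e. mcoeff P k ** (x ^ (k + l) *\<^sub>R W x) ** hconj (mcoeff Q l))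
      absolutely_integrable_on einterval x0 x1"
    by (intro absolutely_integrable_sum) auto
  moreover have "meval P x ** W x ** hconj (meval Q x) =
      (\<Sum>k<d. \<Sum>l<e. mcoeff P k ** (x ^ (k + l) *\<^sub>R W x) ** hconj (mcoeff Q l))" for x
    by (simp add: meval_expand[OF d] meval_expand[OF e] hconj_sum hconj_scaleR cmat_mult.sum_left cmat_mult.sum_right
        cmat_mult.scaleR_left cmat_mult.scaleR_right power_add scaleR_sum_right) (subst sum.swap, simp add: mult.commute)
  ultimately show ?thesis
    by simp
qed

lemma inner_W_mconst_mult:
  assumes "finite_moments x0 x1 W"
  shows "inner_W x0 x1 W (meval (mconst A ** P)) (meval (mconst B ** Q)) =
    A ** inner_W x0 x1 W (meval P) (meval Q) ** hconj B"
proof -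
  have "bounded_linear (\<lambda>X. A ** X ** hconj B)"
    using bounded_linear_compose[OF cmat_mult.bounded_linear_left cmat_mult.bounded_linear_right] .
  from integral_bounded_linear[OF this weight_integrable[OF assms, unfolded set_integrable_def]]
  show ?thesis
    by (simp add: inner_W_def set_lebesgue_integral_def meval_mult hconj_mult matrix_mul_assoc
        cmat_mult.scaleR_left cmat_mult.scaleR_right)
qed

lemma inner_W_diff_left:
  assumes "finite_moments x0 x1 W"
  shows "inner_W x0 x1 W (meval (P - P')) (meval Q) =
    inner_W x0 x1 W (meval P) (meval Q) - inner_W x0 x1 W (meval P') (meval Q)"
  unfolding inner_W_def meval_diff cmat_mult.diff_left
  by (intro set_integral_diff weight_integrable assms)

lemma inner_W_add_right:
  assumes "finite_moments x0 x1 W"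
  shows "inner_W x0 x1 W (meval P) (meval (Q + Q')) =
    inner_W x0 x1 W (meval P) (meval Q) + inner_W x0 x1 W (meval P) (meval Q')"
  unfolding inner_W_def meval_add hconj_add cmat_mult.add_right
  by (intro set_integral_add weight_integrable assms)

text \<open>Otherwise the interval would be the union of a finite set and a null set, whereas a
  nonempty open set is not negligible.\<close>

lemma infinite_if_AE_einterval:
  assumes "x0 < x1" and "AE x in lebesgue. x \<in> einterval x0 x1 \<longrightarrow> R x"
  shows "infinite {x \<in> einterval x0 x1. R x}"
proof
  assume "finite {x \<in> einterval x0 x1. R x}"
  then have "negligible {x \<in> einterval x0 x1. R x}"
    by (rule negligible_finite)
  moreover have "negligible {x. \<not> (x \<in> einterval x0 x1 \<longrightarrow> R x)}"
    using assms(2) by (simp add: completion.AE_iff_null_sets negligible_iff_null_sets)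
  ultimately have "negligible (einterval x0 x1)"
    by (rule negligible_subset[OF negligible_Un]) auto
  moreover have "einterval x0 x1 \<noteq> {}"
    using einterval_nonempty[OF assms(1)] by auto
  ultimately show False
    using open_not_negligible open_einterval by blast
qed

section \<open>Definiteness of the inner product and uniqueness of monic orthogonal
  polynomials\<close>

lemma pos_defD:
  "pos_def A \<Longrightarrow> v \<noteq> 0 \<Longrightarrow> 0 < Re (\<Sum>i\<in>UNIV. \<Sum>j\<in>UNIV. cnj (v $ i) * A $ i $ j * v $ j)"
  unfolding pos_def_def by blast

text \<open>The diagonal entries of the integrand are nonnegative almost everywhere and have
  integral 0, so they vanish almost everywhere. Positive definiteness then makes every row of
  \<open>Q\<close> vanish at infinitely many points.\<close>

lemma inner_W_definite:
  assumes W: "weight_matrix x0 x1 W" and 0: "inner_W x0 x1 W (meval Q) (meval Q) = 0"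
  shows "Q = 0"
proof -
  define F where "F x = meval Q x ** W x ** hconj (meval Q x)" for x
  have pd: "AE x in lebesgue. x \<in> einterval x0 x1 \<longrightarrow> pos_def (W x)"
    and fm: "finite_moments x0 x1 W" and lt: "x0 < x1"
    using W by (simp_all add: weight_matrix_def)
  \<comment> \<open>The diagonal entry is the quadratic form of \<open>W x\<close> at the conjugate
    of row \<open>i\<close> of \<open>meval Q x\<close>.\<close>
  have form: "F x $ i $ i =
      (\<Sum>k\<in>UNIV. \<Sum>l\<in>UNIV. cnj (hconj (meval Q x) $ k $ i) * W x $ k $ l * hconj (meval Q x) $ l $ i)" for x i
  proof -
    have "F x $ i $ i =
        (\<Sum>l\<in>UNIV. \<Sum>k\<in>UNIV. cnj (hconj (meval Q x) $ k $ i) * W x $ k $ l * hconj (meval Q x) $ l $ i)"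
      by (simp add: F_def matrix_matrix_mult_def sum_distrib_right)
    then show ?thesis
      by (subst sum.swap)
  qed
  have pos: "Re (F x $ i $ i) \<ge> 0" "Re (F x $ i $ i) = 0 \<Longrightarrow> meval Q x $ i = 0" if "pos_def (W x)" for x i
  proof -
    define v :: "complex ^ 'a" where "v = (\<chi> k. hconj (meval Q x) $ k $ i)"
    have eq: "Re (F x $ i $ i) = Re (\<Sum>k\<in>UNIV. \<Sum>l\<in>UNIV. cnj (v $ k) * W x $ k $ l * v $ l)"
      by (simp add: form v_def)
    have gt: "Re (F x $ i $ i) > 0" if "v \<noteq> 0"
      unfolding eq using \<open>pos_def (W x)\<close> that by (rule pos_defD)
    have "Re (F x $ i $ i) = 0" if "v = 0"
      unfolding eq that by simp
    with gt show "Re (F x $ i $ i) \<ge> 0"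
      by (cases "v = 0") (simp_all add: less_imp_le)
    assume "Re (F x $ i $ i) = 0"
    with gt have "v = 0"
      by fastforce
    then show "meval Q x $ i = 0"
      by (simp add: v_def vec_eq_iff)
  qed
  have "AE x in lebesgue. x \<in> einterval x0 x1 \<longrightarrow> meval Q x $ i = 0" for i
  proof -
    let ?g = "\<lambda>x. Re ((indicator (einterval x0 x1) x *\<^sub>R F x) $ i $ i)"
    have bl: "bounded_linear (\<lambda>X :: 'a cmat. Re (X $ i $ i))"
      by (intro bounded_linear_compose[OF bounded_linear_Re]
          bounded_linear_compose[OF bounded_linear_vec_nth] bounded_linear_vec_nth)
    have int: "integrable lebesgue (\<lambda>x. indicator (einterval x0 x1) x *\<^sub>R F x)"
      using weight_integrable[OF fm] unfolding F_def set_integrable_def .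
    have "integrable lebesgue ?g"
      by (rule integrable_bounded_linear[OF bl int])
    moreover have "integral\<^sup>L lebesgue ?g = 0"
      using 0 by (simp only: integral_bounded_linear[OF bl int]) (simp add: F_def inner_W_def set_lebesgue_integral_def)
    moreover have "AE x in lebesgue. 0 \<le> ?g x"
      using pd by eventually_elim (simp add: indicator_def pos(1))
    ultimately have "AE x in lebesgue. ?g x = 0"
      using integral_nonneg_eq_0_iff_AE by blast
    with pd show ?thesis
      by eventually_elim (auto intro: pos(2))
  qed
  then have "AE x in lebesgue. \<forall>i. x \<in> einterval x0 x1 \<longrightarrow> meval Q x $ i = 0"
    by (rule eventually_all_finite)
  then have "AE x in lebesgue. x \<in> einterval x0 x1 \<longrightarrow> meval Q x = 0"
    by eventually_elim (simp add: vec_eq_iff)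
  from infinite_if_AE_einterval[OF lt this] show ?thesis
    by (rule meval_eqI) simp
qed

text \<open>\<open>Q\<close> is a left combination of the \<open>P m\<close> with
  \<open>m < n\<close>, each orthogonal to \<open>P n\<close>.\<close>

lemma monic_orthogonal_lower:
  assumes "finite_moments x0 x1 W" and "monic_orthogonal x0 x1 W P" and "\<forall>k\<ge>n. mcoeff Q k = 0"
  shows "inner_W x0 x1 W (meval (P n)) (meval Q) = 0"
  using assms(3)
proof (induction rule: mpoly_basis_induct[where R = P])
  case (basis m)
  then show ?case
    using assms(2) by (simp add: monic_orthogonal_def mdeg_eq_iff)
      (metis invertible_def matrix_mul_lid)
next
  case zero
  show ?case
    by (simp add: inner_W_def)
next
  case (step m A Q)
  have "inner_W x0 x1 W (meval (P n)) (meval (P m)) = 0"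
    using assms(2) step(1) by (auto simp: monic_orthogonal_def)
  \<comment> \<open>The factor \<open>mat 1\<close> brings \<open>P n\<close> into the form that
    \<open>inner_W_mconst_mult\<close> expects.\<close>
  then have "inner_W x0 x1 W (meval (mconst (mat 1) ** P n)) (meval (mconst A ** P m)) = 0"
    by (simp add: inner_W_mconst_mult[OF assms(1)])
  moreover have "mconst (mat 1) ** P n = P n"
    by (rule meval_inj) (simp add: meval_mult)
  ultimately show ?case
    using step by (simp add: inner_W_add_right[OF assms(1)])
qed

text \<open>The leading terms cancel, so \<open>P n - R n\<close> has degree below \<open>n\<close>.
  It is therefore orthogonal to both \<open>P n\<close> and \<open>R n\<close>, hence to
  itself.\<close>

lemma monic_orthogonal_unique:
  assumes W: "weight_matrix x0 x1 W"
    and P: "monic_orthogonal x0 x1 W P" and R: "monic_orthogonal x0 x1 W R"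
  shows "P = R"
proof
  fix n
  have fm: "finite_moments x0 x1 W"
    using W by (simp add: weight_matrix_def)
  have "\<forall>k\<ge>n. mcoeff (P n - R n) k = 0"
    using P R by (auto simp: monic_orthogonal_def mdeg_eq_iff mcoeff_diff le_less)
  then have "inner_W x0 x1 W (meval (P n - R n)) (meval (P n - R n)) = 0"
    using monic_orthogonal_lower[OF fm P] monic_orthogonal_lower[OF fm R] by (simp add: inner_W_diff_left[OF fm])
  then show "P n = R n"
    using inner_W_definite[OF W] by fastforce
qed

section \<open>Points where a weight is invertible\<close>

lemma pos_def_invertible:
  assumes "pos_def A"
  shows "invertible A"
proof -
  have "x = 0" if "A *v x = 0" for x
  proof (rule ccontr)
    assume "x \<noteq> 0"
    have "(\<Sum>i\<in>UNIV. \<Sum>j\<in>UNIV. cnj (x $ i) * A $ i $ j * x $ j) =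
        (\<Sum>i\<in>UNIV. cnj (x $ i) * (A *v x) $ i)"
      by (simp add: matrix_vector_mult_def sum_distrib_left mult.assoc)
    also have "\<dots> = 0"
      using that by simp
    finally show False
      using pos_defD[OF assms \<open>x \<noteq> 0\<close>] by simp
  qed
  then show ?thesis
    by (simp add: invertible_left_inverse matrix_left_invertible_ker)
qed

lemma weight_matrix_AE_invertible:
  assumes "weight_matrix x0 x1 W"
  shows "AE x in lebesgue. x \<in> einterval x0 x1 \<longrightarrow> invertible (W x)"
proof -
  have "AE x in lebesgue. x \<in> einterval x0 x1 \<longrightarrow> pos_def (W x)"
    using assms by (simp add: weight_matrix_def)
  then show ?thesis
    by eventually_elim (auto intro: pos_def_invertible)
qed

text \<open>The integrands differ only on a null set. This allows \<open>fun_act\<close> of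
  \<open>darboux_N\<close>, which is controlled only where \<open>W\<close> is invertible, to be
  replaced by a polynomial.\<close>

lemma inner_W_cong:
  assumes W: "weight_matrix x0 x1 W"
    and eq: "\<And>x. x \<in> einterval x0 x1 \<Longrightarrow> invertible (W x) \<Longrightarrow> g x = meval Q x"
  shows "inner_W x0 x1 W (meval P) g = inner_W x0 x1 W (meval P) (meval Q)"
proof -
  define S where "S = {x. \<not> (x \<in> einterval x0 x1 \<longrightarrow> invertible (W x))}"
  have S: "negligible S"
    using weight_matrix_AE_invertible[OF W]
    by (simp add: S_def completion.AE_iff_null_sets negligible_iff_null_sets)
  have "finite_moments x0 x1 W"
    using W by (simp add: weight_matrix_def)
  note int = weight_integrable[OF this, of P Q]
  have same: "meval P x ** W x ** hconj (g x) = meval P x ** W x ** hconj (meval Q x)"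
    if "x \<in> einterval x0 x1 - S" for x
    using that eq[of x] by (simp add: S_def)
  have int': "(\<lambda>x. meval P x ** W x ** hconj (g x)) absolutely_integrable_on einterval x0 x1"
    by (rule absolutely_integrable_spike[OF int S same])
  show ?thesis
    unfolding inner_W_def set_lebesgue_integral_eq_integral(2)[OF int] set_lebesgue_integral_eq_integral(2)[OF int']
    by (rule integral_spike[OF S]) (simp add: same)
qed

subsection \<open>Operators with polynomial coefficients\<close>

text \<open>Real scalars enter matrix polynomials as factors \<open>mat [:r:]\<close>; evaluation
  turns them into ordinary scalings.\<close>

lemma mat_of_real_mult: "mat (complex_of_real r) ** A = r *\<^sub>R (A :: 'n::finite cmat)"
proof -
  have "mat (complex_of_real r) = r *\<^sub>R (mat 1 :: 'n cmat)"
    by (simp add: vec_eq_iff mat_def of_real_def)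
  then show ?thesis
    by (simp add: cmat_mult.scaleR_left)
qed

lemma fun_act_cong: "(\<And>k. coeff T k x = coeff T' k x) \<Longrightarrow> fun_act f T x = fun_act f T' x"
  by (simp add: fun_act_mono_degree[of _ "max (degree T) (degree T')"])

lemma pdop_from_coeffs:
  assumes "\<And>k. \<exists>G. \<forall>x\<in>S. coeff T k x = meval G x"
  shows "\<exists>E. \<forall>k. \<forall>x\<in>S. coeff T k x = meval (coeff E k) x"
proof -
  obtain G where G: "\<And>k x. x \<in> S \<Longrightarrow> coeff T k x = meval (G k) x"
    using assms by metis
  let ?E = "\<Sum>k\<le>degree T. monom (G k) k"
  have "coeff ?E m = (if m \<le> degree T then G m else 0)" for m
    by (simp add: coeff_sum)
  then have "coeff T m x = meval (coeff ?E m) x" if "x \<in> S" for m x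
    using G[OF that, of m] by (cases "m \<le> degree T") (simp_all add: coeff_eq_0)
  then show ?thesis
    by blast
qed

lemma mpderiv_pow_mat: "(mpderiv ^^ n) (mat p) = mat ((pderiv ^^ n) p)"
  by (simp add: vec_eq_iff mpderiv_pow_nth mat_def)

lemma higher_pderiv_monom_self: "(pderiv ^^ n) (monom 1 n) = [:fact n :: complex:]"
  by (rule poly_eqI) (auto simp: coeff_higher_pderiv coeff_pCons pochhammer_fact split: nat.split)

lemma higher_pderiv_monom_gt: "k < n \<Longrightarrow> (pderiv ^^ n) (monom 1 k :: complex poly) = 0"
  by (rule poly_eqI) (simp add: coeff_higher_pderiv)

text \<open>Testing \<open>T\<close> on \<open>x^k\<close> times the identity gives a triangular
  system: terms of order above \<open>k\<close> vanish, those below are known by induction, and the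
  term of order \<open>k\<close> is \<open>fact k\<close> times the wanted coefficient.\<close>

lemma pdop_from_action:
  assumes "\<And>Q. \<exists>R. \<forall>x\<in>S. fun_act (meval Q) T x = meval R x"
  shows "\<exists>E. \<forall>k. \<forall>x\<in>S. coeff T k x = meval (coeff E k) x"
proof (rule pdop_from_coeffs)
  fix k
  show "\<exists>G. \<forall>x\<in>S. coeff T k x = meval G x"
  proof (induction k rule: less_induct)
    case (less k)
    then obtain G where G: "\<And>i x. i < k \<Longrightarrow> x \<in> S \<Longrightarrow> coeff T i x = meval (G i) x"
      by metis
    let ?X = "mat (monom 1 k) :: 'a mpoly"
    obtain R where R: "\<And>x. x \<in> S \<Longrightarrow> fun_act (meval ?X) T x = meval R x"
      using assms by metis
    have "coeff T k x = meval (mat [:of_real (1 / fact k):] ** (R - (\<Sum>i<k. (mpderiv ^^ i) ?X ** G i))) x"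
      if "x \<in> S" for x
    proof -
      define t where "t i = meval ((mpderiv ^^ i) ?X) x ** coeff T i x" for i
      \<comment> \<open>The maximum keeps the term \<open>t k\<close> in the sum even when
        \<open>k\<close> exceeds the degree of \<open>T\<close>.\<close>
      have "meval R x = (\<Sum>i\<le>max k (degree T). t i)"
        using R[OF that] by (simp add: fun_act_mono_degree[of T "max k (degree T)"] iter_deriv_meval t_def)
      also have "\<dots> = (\<Sum>i\<le>k. t i)"
        by (rule sum.mono_neutral_right) (auto simp: t_def mpderiv_pow_mat higher_pderiv_monom_gt)
      also have "\<dots> = (\<Sum>i<k. t i) + t k"
        by (simp flip: lessThan_Suc_atMost)
      also have "t k = fact k *\<^sub>R coeff T k x"
        using mat_of_real_mult[of "fact k"] by (simp add: t_def mpderiv_pow_mat higher_pderiv_monom_self)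
      also have "(\<Sum>i<k. t i) = meval (\<Sum>i<k. (mpderiv ^^ i) ?X ** G i) x"
        using G that by (simp add: t_def meval_sum meval_mult)
      finally have "meval (R - (\<Sum>i<k. (mpderiv ^^ i) ?X ** G i)) x = fact k *\<^sub>R coeff T k x"
        by (simp add: meval_diff)
      then show ?thesis
        unfolding meval_mult meval_mat by (simp add: mat_of_real_mult del: of_real_divide of_real_1)
    qed
    then show ?case
      by blast
  qed
qed

text \<open>Coefficients of \<open>T\<close> enter the product undifferentiated, so pointwise
  agreement on an arbitrary set \<open>S\<close> is enough.\<close>

lemma pdop_op_mult:
  assumes T: "\<And>k x. x \<in> S \<Longrightarrow> coeff T k x = meval (coeff N k) x"
  shows "\<exists>E. \<forall>k. \<forall>x\<in>S. coeff (fdop_of A \<odot> T) k x = meval (coeff E k) x"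
proof (rule pdop_from_coeffs)
  fix m
  let ?G = "\<Sum>i\<le>degree A. \<Sum>j\<le>degree T. \<Sum>k\<le>j. if i + k = m
     then mat [:of_real (of_nat (j choose k)):] ** ((mpderiv ^^ (j - k)) (coeff A i) ** coeff N j) else 0"
  have "coeff (fdop_of A \<odot> T) m x = meval ?G x" if "x \<in> S" for x
    by (simp add: coeff_op_mult degree_fdop_of coeff_fdop_of iter_deriv_meval T[OF that] meval_sum meval_mult
        if_distrib[of "\<lambda>P. meval P x"] mat_of_real_mult del: of_real_of_nat_eq cong: if_cong)
  then show "\<exists>G. \<forall>x\<in>S. coeff (fdop_of A \<odot> T) m x = meval G x"
    by blast
qed

subsection \<open>Leading coefficients\<close>

text \<open>Only \<open>i = a\<close> and \<open>j = k = b\<close> reach the exponent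
  \<open>a + b\<close>, and there nothing is differentiated. The bounds \<open>a\<close> and
  \<open>b\<close> need not be attained, and \<open>E\<close> is constrained only at the point
  \<open>x\<close>.\<close>

lemma coeff_op_mult_top:
  assumes "degree D \<le> a" and "\<And>j. j > b \<Longrightarrow> coeff E j x = 0"
  shows "coeff (D \<odot> E) (a + b) x = coeff D a x ** coeff E b x"
    and "m > a + b \<Longrightarrow> coeff (D \<odot> E) m x = 0"
proof -
  let ?Z = "coeff D a x ** coeff E b x"
  have "(if i + k = a + b then of_nat (j choose k) *\<^sub>R (iter_deriv (j - k) (coeff D i) x ** coeff E j x) else 0)
      = (if i = a \<and> j = b \<and> k = b then ?Z else 0)" if "i \<le> degree D" "k \<le> j" for i j k
  proof (cases "j > b")
    case True
    then show ?thesis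
      using assms(2) by simp
  next
    case False
    then have "i + k = a + b \<longleftrightarrow> i = a \<and> j = b \<and> k = b"
      using that assms(1) by auto
    then show ?thesis
      by (simp add: iter_deriv_def)
  qed
  then have "coeff (D \<odot> E) (a + b) x =
      (\<Sum>i\<le>degree D. \<Sum>j\<le>degree E. \<Sum>k\<le>j. if i = a \<and> j = b \<and> k = b then ?Z else 0)"
    unfolding coeff_op_mult by (intro sum.cong refl) simp
  also have "\<dots> = (\<Sum>i\<le>degree D. \<Sum>j\<le>degree E. if j = b then (if i = a then ?Z else 0) else 0)"
  proof (intro sum.cong refl)
    fix i j
    show "(\<Sum>k\<le>j. if i = a \<and> j = b \<and> k = b then ?Z else 0) =
        (if j = b then (if i = a then ?Z else 0) else 0)"
      by (cases "i = a \<and> j = b") auto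
  qed
  also have "\<dots> = (\<Sum>i\<le>degree D. if i = a then (if b \<le> degree E then ?Z else 0) else 0)"
    by (intro sum.cong refl) (simp add: sum.delta)
  also have "\<dots> = ?Z"
    by (simp add: sum.delta coeff_eq_0)
  finally show "coeff (D \<odot> E) (a + b) x = ?Z" .
  show "coeff (D \<odot> E) m x = 0" if "m > a + b"
  proof -
    have "coeff E j x = 0" if "i \<le> degree D" "k \<le> j" "i + k = m" for i j k
      using that \<open>m > a + b\<close> assms by auto
    then show ?thesis
      unfolding coeff_op_mult by (intro sum.neutral ballI) simp
  qed
qed

lemma degree_op_mult_le:
  assumes "degree D \<le> a" and "degree E \<le> b"
  shows "degree (D \<odot> E) \<le> a + b"
proof (rule degree_le, intro allI impI ext)
  fix m x
  assume "m > a + b"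
  then have "coeff (D \<odot> E) m x = 0"
    using assms by (intro coeff_op_mult_top(2)[where a = a and b = b]) (simp_all add: coeff_eq_0)
  then show "coeff (D \<odot> E) m x = 0 x"
    by simp
qed

text \<open>The summand of index \<open>j\<close> has order at most \<open>j\<close>, so only the
  last one contributes; the sign is that of the power of \<open>-\<partial>\<close>.\<close>

lemma formal_adjoint_top:
  shows "coeff (formal_adjoint D) (degree D) x = (- 1) ^ degree D *\<^sub>R hconj (coeff D (degree D) x)"
    and "degree (formal_adjoint D) \<le> degree D"
proof -
  define t where "t j = fun_op (\<lambda>x. (- 1) ^ j *\<^sub>R hconj (coeff D j x)) \<odot> monom (\<lambda>x. mat 1) j" for j
  have top: "coeff (t j) j x = (- 1) ^ j *\<^sub>R hconj (coeff D j x)" for j x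
    using coeff_op_mult_top(1)[of "fun_op (\<lambda>x. (- 1) ^ j *\<^sub>R hconj (coeff D j x))" 0 j "monom (\<lambda>x. mat 1) j" x]
    by (simp add: t_def fun_op_def degree_monom_le monom_0)
  have le: "degree (t j) \<le> j" for j
    using degree_op_mult_le[of "fun_op (\<lambda>x. (- 1) ^ j *\<^sub>R hconj (coeff D j x))" 0 "monom (\<lambda>x. mat 1) j" j]
    by (simp add: t_def fun_op_def degree_monom_le monom_0)
  have adj: "formal_adjoint D = (\<Sum>j\<le>degree D. t j)"
    by (simp add: formal_adjoint_def t_def)
  show "degree (formal_adjoint D) \<le> degree D"
    unfolding adj using le by (intro degree_sum_le) (auto intro: order_trans)
  have "coeff (formal_adjoint D) (degree D) x = (\<Sum>j\<le>degree D. coeff (t j) (degree D) x)"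
    by (simp add: adj coeff_sum sum_fun_apply)
  also have "\<dots> = (\<Sum>j\<le>degree D. if j = degree D then coeff (t j) j x else 0)"
  proof (intro sum.cong refl)
    fix j assume "j \<in> {..degree D}"
    then have "degree (t j) < degree D" if "j \<noteq> degree D"
      using le[of j] that by auto
    then show "coeff (t j) (degree D) x = (if j = degree D then coeff (t j) j x else 0)"
      by (auto simp: coeff_eq_0)
  qed
  finally show "coeff (formal_adjoint D) (degree D) x = (- 1) ^ degree D *\<^sub>R hconj (coeff D (degree D) x)"
    by (simp add: top)
qed

text \<open>The outer factors \<open>W'\<close> and the inverse of \<open>W\<close> have order zero,
  so they multiply the top coefficient of the adjoint and affect derivatives only in lower
  order.\<close>

lemma darboux_N_top:
  shows "coeff (darboux_N W W' V) (degree V) x =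
      (- 1) ^ degree V *\<^sub>R (W' x ** hconj (meval (lead_coeff V) x) ** matrix_inv (W x))"
    and "degree (darboux_N W W' V) \<le> degree V"
proof -
  let ?A = "formal_adjoint (fdop_of V)"
  have A: "degree ?A \<le> degree V"
    "coeff ?A (degree V) x = (- 1) ^ degree V *\<^sub>R hconj (meval (lead_coeff V) x)"
    using formal_adjoint_top[of "fdop_of V"] by (simp_all add: degree_fdop_of coeff_fdop_of)
  have d0: "degree (fun_op F) \<le> 0" for F :: "real \<Rightarrow> 'a cmat"
    by (simp add: fun_op_def degree_monom_le monom_0)
  have B: "degree (fun_op W' \<odot> ?A) \<le> degree V"
    using degree_op_mult_le[OF d0 A(1)] by simp
  show "degree (darboux_N W W' V) \<le> degree V"
    using degree_op_mult_le[OF B d0] by (simp add: darboux_N_def)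
  have "coeff (fun_op W' \<odot> ?A) (degree V) x = W' x ** coeff ?A (degree V) x"
    using coeff_op_mult_top(1)[OF d0, of "degree V" ?A x W'] A(1) by (simp add: coeff_eq_0 fun_op_def monom_0)
  then show "coeff (darboux_N W W' V) (degree V) x =
      (- 1) ^ degree V *\<^sub>R (W' x ** hconj (meval (lead_coeff V) x) ** matrix_inv (W x))"
    using coeff_op_mult_top(1)[OF B, of 0 "fun_op (\<lambda>x. matrix_inv (W x))" x] A(2)
    by (simp add: darboux_N_def fun_op_def cmat_mult.scaleR_left cmat_mult.scaleR_right)
qed

lemma det_meval: "det (meval P x) = poly (det P) (of_real x)"
  by (simp add: det_def meval_def poly_sum poly_prod)

text \<open>The weights are singular only on null sets, and \<open>det F\<close> has finitely many
  real roots.\<close>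

lemma infinite_invertible_points:
  assumes W: "weight_matrix x0 x1 W" and W': "weight_matrix x0 x1 W'" and F: "det F \<noteq> 0"
  shows "infinite {x \<in> einterval x0 x1. invertible (W x) \<and> invertible (W' x) \<and> invertible (meval F x)}"
proof -
  have "x0 < x1"
    using W by (simp add: weight_matrix_def)
  moreover have "AE x in lebesgue. x \<in> einterval x0 x1 \<longrightarrow> invertible (W x) \<and> invertible (W' x)"
    using weight_matrix_AE_invertible[OF W] weight_matrix_AE_invertible[OF W'] by eventually_elim auto
  ultimately have "infinite {x \<in> einterval x0 x1. invertible (W x) \<and> invertible (W' x)}"
    by (rule infinite_if_AE_einterval)
  moreover have "finite {x. poly (det F) (complex_of_real x) = 0}"
    using finite_vimageI[OF poly_roots_finite[OF F] inj_of_real] by (simp add: vimage_def)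
  ultimately have "infinite ({x \<in> einterval x0 x1. invertible (W x) \<and> invertible (W' x)} -
      {x. poly (det F) (complex_of_real x) = 0})"
    by (rule Diff_infinite_finite[rotated])
  then show ?thesis
    by (rule contrapos_nn) (auto elim!: rev_finite_subset simp: invertible_det_nz det_meval)
qed

text \<open>\<open>E\<close> is known only where \<open>W\<close> is invertible, so its coefficients
  are compared on an infinite set of good points. The summand \<open>2 * degree V\<close> is even,
  which preserves parity.\<close>

lemma degree_conjugated_op:
  assumes W: "weight_matrix x0 x1 W" and W': "weight_matrix x0 x1 W'" and V: "det (lead_coeff V) \<noteq> 0"
    and E: "represents x0 x1 W (fdop_of V \<odot> fdop_of D \<odot> darboux_N W W' V) E"
    and D: "D \<noteq> 0"
  shows "E \<noteq> 0" and "degree E = 2 * degree V + degree D"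
proof -
  let ?v = "degree V" and ?d = "degree D"
  let ?B = "fdop_of V \<odot> fdop_of D" and ?N = "darboux_N W W' V"
  define S where
    "S = {x \<in> einterval x0 x1. invertible (W x) \<and> invertible (W' x) \<and> invertible (meval (lead_coeff V) x)}"
  have inf: "infinite S"
    unfolding S_def by (rule infinite_invertible_points[OF W W' V])
  have coeffE: "meval (coeff E k) x = coeff (?B \<odot> ?N) k x" if "x \<in> S" for k x
    using E that by (simp add: represents_def S_def)
  have B: "degree ?B \<le> ?v + ?d"
    by (rule degree_op_mult_le) (simp_all add: degree_fdop_of)
  have N: "coeff ?N j x = 0" if "j > ?v" for j x
    using darboux_N_top(2)[of W W' V] that by (simp add: coeff_eq_0)
  have Btop: "coeff ?B (?v + ?d) x = meval (lead_coeff V) x ** meval (lead_coeff D) x" for x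
    using coeff_op_mult_top(1)[of "fdop_of V" ?v ?d "fdop_of D" x]
    by (simp add: degree_fdop_of coeff_fdop_of coeff_eq_0)
  have "coeff E m = 0" if "m > ?v + ?d + ?v" for m
  proof (rule meval_eqI[OF inf])
    fix x assume "x \<in> S"
    then show "meval (coeff E m) x = meval 0 x"
      using coeff_op_mult_top(2)[OF B, of ?v ?N x m] N that by (simp add: coeffE)
  qed
  then have le: "degree E \<le> ?v + ?d + ?v"
    by (intro degree_le) blast
  have "coeff E (?v + ?d + ?v) \<noteq> 0"
  proof
    assume 0: "coeff E (?v + ?d + ?v) = 0"
    have "lead_coeff D = 0"
    proof (rule meval_eqI[OF inf])
      fix x assume x: "x \<in> S"
      let ?F = "meval (lead_coeff V) x" and ?L = "meval (lead_coeff D) x"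
      let ?M = "W' x ** hconj ?F ** matrix_inv (W x)"
      have "coeff (?B \<odot> ?N) (?v + ?d + ?v) x = (- 1) ^ ?v *\<^sub>R ((?F ** ?L) ** ?M)"
        using coeff_op_mult_top(1)[OF B N] by (simp add: Btop darboux_N_top(1) cmat_mult.scaleR_right)
      then have FLM: "(?F ** ?L) ** ?M = 0"
        using coeffE[OF x, of "?v + ?d + ?v"] 0 by simp
      have F: "invertible ?F" and "invertible (W' x)" "invertible (W x)"
        using x by (auto simp: S_def)
      moreover have "invertible (matrix_inv (W x))"
        using matrix_inv_inverse[OF \<open>invertible (W x)\<close>] unfolding invertible_def by blast
      ultimately have M: "invertible ?M"
        by (intro invertible_mult invertible_hconj)
      \<comment> \<open>Cancelling the invertible factors on both sides isolates the leading
        coefficient of \<open>D\<close>.\<close>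
      have "?L = (matrix_inv ?F ** ?F) ** ?L ** (?M ** matrix_inv ?M)"
        by (simp only: matrix_inv_inverse[OF F] matrix_inv_inverse[OF M] matrix_mul_lid matrix_mul_rid)
      also have "\<dots> = matrix_inv ?F ** ((?F ** ?L) ** ?M) ** matrix_inv ?M"
        by (simp only: matrix_mul_assoc)
      finally show "?L = meval 0 x"
        by (simp only: FLM cmat_mult.zero_left cmat_mult.zero_right meval_0 zero_fun_apply)
    qed
    with D show False
      by simp
  qed
  then show "E \<noteq> 0" and "degree E = 2 * ?v + ?d"
    using le le_degree[of E "?v + ?d + ?v"] by auto
qed

section \<open>The conjugated operator and its eigenvalues\<close>

lemma mconst_mult: "mconst (A ** B) = mconst A ** mconst B"
  by (rule meval_inj) (simp add: meval_mult)

theorem theorem3p10: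
  fixes x0 x1 :: ereal
    and W W' :: "real \<Rightarrow> complex ^ 'n::finite ^ 'n"
    and V D' :: "'n pdop"
  assumes "weight_matrix x0 x1 W"
    and "weight_matrix x0 x1 W'"
    and "strong_darboux_transformation x0 x1 W W'"
    and "strong_darboux_transformer x0 x1 W W' V"
    and "D' \<in> diff_algebra x0 x1 W'"
  shows "\<exists>E \<in> diff_algebra x0 x1 W.
           represents x0 x1 W (fdop_of V \<odot> fdop_of D' \<odot> darboux_N W W' V) E \<and>
           (even_order D' \<longrightarrow> even_order E) \<and>
           (odd_order D' \<longrightarrow> odd_order E)"
proof -
  let ?N = "darboux_N W W' V"
  define S where "S = {x \<in> einterval x0 x1. invertible (W x)}"
  have dp: "degree_preserving V" and lead: "det (lead_coeff V) \<noteq> 0"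
    and adjoint: "\<And>P Q. inner_W x0 x1 W' (meval (poly_act P V)) (meval Q) =
      inner_W x0 x1 W (meval P) (fun_act (meval Q) ?N)"
    using assms(4) unfolding strong_darboux_transformer_def by blast+
  obtain D where "D \<in> diff_algebra x0 x1 W" and D: "represents x0 x1 W (fdop_of V \<odot> ?N) D"
    using assms(4) unfolding strong_darboux_transformer_def by blast
  then obtain P \<Lambda> where P: "monic_orthogonal x0 x1 W P"
    and P_D: "\<And>n. poly_act (P n) D = mconst (\<Lambda> n) ** P n"
    unfolding diff_algebra_def mem_Collect_eq by metis
  obtain P' \<Lambda>' where P': "monic_orthogonal x0 x1 W' P'"
    and P'_D': "\<And>n. poly_act (P' n) D' = mconst (\<Lambda>' n) ** P' n"
    using assms(5) unfolding diff_algebra_def mem_Collect_eq by metis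
  have fm: "finite_moments x0 x1 W" and lt: "x0 < x1"
    using assms(1) by (simp_all add: weight_matrix_def)
  have inf: "infinite S"
    unfolding S_def by (rule infinite_if_AE_einterval[OF lt weight_matrix_AE_invertible[OF assms(1)]])

  have VN: "fun_act (meval (poly_act Q V)) ?N x = meval (poly_act Q D) x" if "x \<in> S" for Q x
    unfolding fun_act_op_mult[symmetric] meval_poly_act[of Q D]
    by (rule fun_act_cong) (use D that in \<open>simp add: represents_def S_def coeff_fdop_of\<close>)
  \<comment> \<open>Writing \<open>Q\<close> as \<open>poly_act P V\<close> turns the action of
    \<open>?N\<close> on \<open>Q\<close> into the action of \<open>D\<close> on
    \<open>P\<close>.\<close>
  have "\<exists>R. \<forall>x\<in>S. fun_act (meval Q) ?N x = meval R x" for Q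
    using degree_preserving_surj[OF dp, of Q] VN by blast
  from pdop_from_action[OF this] obtain N
    where N: "\<And>k x. x \<in> S \<Longrightarrow> coeff ?N k x = meval (coeff N k) x"
    by blast
  obtain U where U: "\<And>k x. coeff (fdop_of V \<odot> fdop_of D') k x = meval (coeff U k) x"
    using pdop_op_mult[where A = V and S = UNIV and T = "fdop_of D'" and N = D', OF coeff_fdop_of[THEN fun_cong]]
    by blast
  then have VD': "fdop_of V \<odot> fdop_of D' = fdop_of U"
    by (intro poly_eqI ext) (simp add: coeff_fdop_of)
  have U_act: "poly_act Q U = poly_act (poly_act Q V) D'" for Q
    by (rule meval_inj) (simp only: meval_poly_act[of Q U] VD'[symmetric] fun_act_op_mult meval_poly_act[of _ D'])
  obtain E where E: "\<And>k x. x \<in> S \<Longrightarrow> coeff (fdop_of U \<odot> ?N) k x = meval (coeff E k) x"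
    using pdop_op_mult[where A = U and S = S, OF N] by blast
  have E_act: "meval (poly_act Q E) x = fun_act (meval (poly_act (poly_act Q V) D')) ?N x" if "x \<in> S" for Q x
  proof -
    have "fun_act (meval Q) (fdop_of E) x = fun_act (meval Q) (fdop_of U \<odot> ?N) x"
      by (rule fun_act_cong) (simp add: E[OF that] coeff_fdop_of)
    then show ?thesis
      by (simp only: fun_act_op_mult U_act meval_poly_act[of Q E])
  qed

  define C where "C n = mcoeff (poly_act (P n) V) n" for n
  \<comment> \<open>The image of \<open>P n\<close> under \<open>V\<close>, normalised to be monic;
    it is the candidate for the monic orthogonal polynomial of \<open>W'\<close>.\<close>
  define R where "R n = poly_act (mconst (matrix_inv (C n)) ** P n) V" for n
  have deg: "mdeg (P n) = ereal (real n)" "mcoeff (P n) n = mat 1" for n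
    using P by (auto simp: monic_orthogonal_def)
  have invC: "invertible (C n)" for n
    unfolding C_def by (rule degree_preserving_lead(2)[OF dp deg])
  have R_lead: "mcoeff (R n) n = mat 1" and R_top: "\<forall>k>n. mcoeff (R n) k = 0" for n
    using degree_preserving_lead(1)[OF dp deg, of n] matrix_inv_inverse(2)[OF invC, of n]
    by (simp_all add: R_def poly_act_mconst_mult mcoeff_mconst_mult C_def)
  have "monic_orthogonal x0 x1 W' R"
    unfolding monic_orthogonal_def
  proof (intro conjI allI impI)
    show "mdeg (R n) = ereal (real n)" "mcoeff (R n) n = mat 1" for n
      using R_lead[of n] R_top[of n] by (simp_all add: mdeg_eq_iff) (simp add: vec_eq_iff mat_def)
    fix n m :: nat
    assume "n \<noteq> m"
    \<comment> \<open>Adjointness moves \<open>V\<close> from \<open>R n\<close> to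
      \<open>?N\<close> acting on \<open>R m\<close>. Since \<open>V\<close> followed by
      \<open>?N\<close> acts as \<open>D\<close>, the latter is \<open>mconst ?B ** P m\<close>, and
      orthogonality for \<open>W\<close> applies.\<close>
    let ?A = "matrix_inv (C n)" and ?B = "matrix_inv (C m) ** \<Lambda> m"
    have "fun_act (meval (R m)) ?N x = meval (mconst ?B ** P m) x" if "x \<in> S" for x
      unfolding R_def VN[OF that] by (simp add: poly_act_mconst_mult P_D mconst_mult matrix_mul_assoc)
    then have "inner_W x0 x1 W (meval (mconst ?A ** P n)) (fun_act (meval (R m)) ?N) =
        inner_W x0 x1 W (meval (mconst ?A ** P n)) (meval (mconst ?B ** P m))"
      by (intro inner_W_cong[OF assms(1)]) (simp add: S_def)
    then show "inner_W x0 x1 W' (meval (R n)) (meval (R m)) = 0"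
      using P \<open>n \<noteq> m\<close> unfolding R_def[of n] adjoint
      by (simp add: inner_W_mconst_mult[OF fm] monic_orthogonal_def)
  qed
  \<comment> \<open>The eigenvalue equations of \<open>D'\<close>, given for \<open>P'\<close>, now
    hold for \<open>R\<close>.\<close>
  then have "P' = R"
    by (rule monic_orthogonal_unique[OF assms(2) P'])

  have "poly_act (P n) E = mconst (C n ** \<Lambda>' n ** matrix_inv (C n) ** \<Lambda> n) ** P n" for n
  proof (rule meval_eqI[OF inf])
    fix x assume x: "x \<in> S"
    have "mconst (C n) ** R n = poly_act (P n) V"
      by (rule meval_inj) (simp add: R_def poly_act_mconst_mult meval_mult matrix_mul_assoc
          matrix_inv_inverse(1)[OF invC])
    then have "poly_act (poly_act (P n) V) D' = mconst (C n) ** (mconst (\<Lambda>' n) ** R n)"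
      by (metis poly_act_mconst_mult P'_D' \<open>P' = R\<close>)
    \<comment> \<open>Expressing the result as an image under \<open>V\<close> again lets
      \<open>VN\<close> replace \<open>V\<close> followed by \<open>?N\<close> by \<open>D\<close>,
      which contributes the last factor \<open>\<Lambda> n\<close>.\<close>
    also have "\<dots> = poly_act (mconst (C n ** \<Lambda>' n ** matrix_inv (C n)) ** P n) V"
      by (simp add: R_def poly_act_mconst_mult mconst_mult flip: matrix_mul_assoc)
    finally have eq: "poly_act (poly_act (P n) V) D' =
        poly_act (mconst (C n ** \<Lambda>' n ** matrix_inv (C n)) ** P n) V" .
    show "meval (poly_act (P n) E) x =
        meval (mconst (C n ** \<Lambda>' n ** matrix_inv (C n) ** \<Lambda> n) ** P n) x"
      unfolding E_act[OF x] eq VN[OF x] by (simp add: poly_act_mconst_mult P_D mconst_mult flip: matrix_mul_assoc)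
  qed
  with P have "E \<in> diff_algebra x0 x1 W"
    unfolding diff_algebra_def by blast
  moreover have rep: "represents x0 x1 W (fdop_of V \<odot> fdop_of D' \<odot> ?N) E"
    using E by (simp add: represents_def S_def VD')
  moreover have "(even_order D' \<longrightarrow> even_order E) \<and> (odd_order D' \<longrightarrow> odd_order E)"
    using degree_conjugated_op[OF assms(1,2) lead rep] by (auto simp: even_order_def odd_order_def)
  ultimately show ?thesis
    by blast
qed

end
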